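(* Let $D\ge 2$, $L\ge 2$ be integers, let $\boldsymbol{\mu}_1,\dots,\boldsymbol{\mu}_L\in\mathbb{R}^D$, let $\mathbf{C}\in\mathbb{R}^{D\times D}$ be symmetric positive definite, let $K_a\ge 1$ be an integer, and let $\sigma_{\mathrm{nor}}^2>0$ and $\gamma_{\mathrm{sen}}>0$ be real. Let $S\in\{1,\dots,D\}$ and let $\mathbf{P}\in\mathbb{R}^{D\times S}$ be a fixed compression matrix of full column rank $S$. Let $\mathcal{G}(S,G)$ denote the receive discriminant gain with compression matrix $\mathbf{P}$ and processing gain $G$. Then the receive discriminant gain is monotonically increasing in the processing gain, in the sense that $$\mathcal{G}(S,G+1)\ \ge\ \mathcal{G}(S,G)\qquad\text{for all } G\in\{1,2,\dots,D-1\}.$$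
   Context: Here $D$ is the feature dimension, $L$ the number of classes, $\boldsymbol{\mu}_\ell$ the centroid of class $\ell$, $\mathbf{C}$ the common class covariance matrix, $K_a=|\mathcal{K}|$ the number of active sensors, $\sigma_{\mathrm{nor}}^2$ the normalization variance, and $\gamma_{\mathrm{sen}}$ the receive signal-to-interference ratio. The closest class pair is a pair $(\ell,\ell')$ with $$(\ell,\ell')\in\arg\min_{\ell_1\ne\ell_2}(\boldsymbol{\mu}_{\ell_1}-\boldsymbol{\mu}_{\ell_2})^{\mathsf T}\mathbf{C}^{-1}(\boldsymbol{\mu}_{\ell_1}-\boldsymbol{\mu}_{\ell_2}),$$ fixed once and for all, and $\boldsymbol{\mu}_{\ell\ell'}=\boldsymbol{\mu}_\ell-\boldsymbol{\mu}_{\ell'}$. For a compression matrix $\mathbf{P}\in\mathbb{R}^{D\times S}$ of full column rank $S$ and processing gain $G$ (a positive integer), the covariance matrix of the received feature vector is $$\hat{\mathbf{C}}=\frac{1}{K_a}\mathbf{P}^{\mathsf T}\mathbf{C}\mathbf{P}+\frac{\sigma_{\mathrm{nor}}^2}{G K_a^2\gamma_{\mathrm{sen}}}\mathbf{I}_S,$$ and the receive discriminant gain is $$\mathcal{G}(S,G)=\boldsymbol{\mu}_{\ell\ell'}^{\mathsf T}\mathbf{P}\hat{\mathbf{C}}^{-1}\mathbf{P}^{\mathsf T}\boldsymbol{\mu}_{\ell\ell'}.$$ *)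

theory Defs
  imports "HOL-Analysis.Analysis"
begin

definition sym_pos_def :: "real^'n^'n \<Rightarrow> bool" where
  "sym_pos_def A \<longleftrightarrow> transpose A = A \<and> (\<forall>x. x \<noteq> 0 \<longrightarrow> x \<bullet> (A *v x) > 0)"

(* Classes are numbered 1..L; values of mu outside this range are irrelevant. *)
definition closest_class_pair ::
    "nat \<Rightarrow> (nat \<Rightarrow> real^'d) \<Rightarrow> real^'d^'d \<Rightarrow> nat \<times> nat \<Rightarrow> bool" where
  "closest_class_pair L mu C p \<longleftrightarrow>
     is_arg_min (\<lambda>(l1, l2). (mu l1 - mu l2) \<bullet> (matrix_inv C *v (mu l1 - mu l2)))
                (\<lambda>(l1, l2). l1 \<in> {1..L} \<and> l2 \<in> {1..L} \<and> l1 \<noteq> l2) p"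

(* A D x S matrix has type real^'s^'d with D = CARD('d), S = CARD('s).
   The argument sigma2 stands for the variance itself, not for its square root. *)
definition received_cov ::
    "real^'d^'d \<Rightarrow> nat \<Rightarrow> real \<Rightarrow> real \<Rightarrow> real^'s^'d \<Rightarrow> nat \<Rightarrow> real^'s^'s" where
  "received_cov C Ka sigma2 gamma P G =
     (1 / real Ka) *\<^sub>R (transpose P ** C ** P)
     + (sigma2 / (real G * (real Ka)\<^sup>2 * gamma)) *\<^sub>R mat 1"

definition receive_discriminant_gain ::
    "(nat \<Rightarrow> real^'d) \<Rightarrow> nat \<times> nat \<Rightarrow> real^'d^'d \<Rightarrow> nat \<Rightarrow> real \<Rightarrow> real \<Rightarrow> real^'s^'d \<Rightarrow> nat \<Rightarrow> real" where
  "receive_discriminant_gain mu p C Ka sigma2 gamma P G =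
     (let v = mu (fst p) - mu (snd p)
      in v \<bullet> ((P ** matrix_inv (received_cov C Ka sigma2 gamma P G) ** transpose P) *v v))"

end

(* The inverse reverses the Loewner order on positive definite matrices, and the received
   covariance decreases in G because only its noise term depends on G, through the factor 1/G. *)
theory Submission
  imports Defs
begin

text \<open>Put \<open>w = transpose P *v v\<close>, where \<open>v\<close> is the centroid
  difference. The gain is the quadratic form of the inverse received covariance at \<open>w\<close>,
  and \<open>w\<close> does not depend on \<open>G\<close>. Raising \<open>G\<close> shrinks only
  the multiple of the identity in the covariance, which therefore falls in the Loewner order
  (\<open>received_cov_antimono\<close>) while staying positive definite
  (\<open>received_cov_sym_pos_def\<close>). Inversion reverses that order
  (\<open>matrix_inv_antimono\<close>), so the gain rises.\<close>

lemma sym_pos_def_invertible: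
  fixes A :: "real^'n^'n"
  assumes "sym_pos_def A"
  shows "invertible A"
proof -
  have "x = 0" if "A *v x = 0" for x
    using assms that unfolding sym_pos_def_def by (metis inner_zero_right less_irrefl)
  then show ?thesis
    unfolding invertible_left_inverse matrix_left_invertible_ker by blast
qed

lemma matrix_inv_right:
  assumes "invertible A"
  shows "A ** matrix_inv A = mat 1"
  using someI_ex[OF assms[unfolded invertible_def]] unfolding matrix_inv_def by blast

lemma mult_matrix_inv_vector:
  fixes A :: "real^'n^'n"
  assumes "invertible A"
  shows "A *v (matrix_inv A *v w) = w"
  using assms by (simp add: matrix_vector_mul_assoc matrix_inv_right)

text \<open>Variational argument: the right-hand side is the maximum over \<open>y\<close> of
  \<open>2 * (w \<bullet> y) - y \<bullet> (A *v y)\<close>, attained at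
  \<open>matrix_inv A *v w\<close>. Testing with \<open>y = matrix_inv B *v w\<close> and bounding
  \<open>A\<close> by \<open>B\<close> leaves \<open>w \<bullet> y\<close>, the left-hand side. This
  avoids matrix square roots and simultaneous diagonalization.\<close>

lemma matrix_inv_antimono:
  fixes A B :: "real^'n^'n"
  assumes A: "sym_pos_def A" and B: "sym_pos_def B"
    and le: "\<And>x. x \<bullet> (A *v x) \<le> x \<bullet> (B *v x)"
  shows "w \<bullet> (matrix_inv B *v w) \<le> w \<bullet> (matrix_inv A *v w)"
proof -
  define x where "x = matrix_inv A *v w"
  define y where "y = matrix_inv B *v w"
  have Ax: "A *v x = w" and By: "B *v y = w"
    unfolding x_def y_def
    using A B by (simp_all add: mult_matrix_inv_vector sym_pos_def_invertible)
  \<comment> \<open>Symmetry of \<open>A\<close> makes this cross term equal to the other one,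
    \<open>y \<bullet> (A *v x)\<close>, when the square is expanded.\<close>
  have "x \<bullet> (A *v y) = w \<bullet> y"
    using A Ax unfolding sym_pos_def_def by (metis dot_lmul_matrix transpose_matrix_vector)
  then have "(x - y) \<bullet> (A *v (x - y)) = w \<bullet> x - 2 * (w \<bullet> y) + y \<bullet> (A *v y)"
    using Ax by (simp add: matrix_vector_mult_diff_distrib inner_diff_left inner_diff_right
        inner_commute)
  moreover have "(x - y) \<bullet> (A *v (x - y)) \<ge> 0"
    using A unfolding sym_pos_def_def by (cases "x = y") (auto intro: less_imp_le)
  moreover have "y \<bullet> (A *v y) \<le> w \<bullet> y"
    using le[of y] By by (simp add: inner_commute)
  ultimately show ?thesis
    unfolding x_def y_def by linarith
qed

lemma transpose_add: "transpose (A + B) = transpose A + transpose B"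
  by (simp add: transpose_def vec_eq_iff)

lemma inner_matrix_vector_transpose:
  fixes A :: "real^'n^'m"
  shows "v \<bullet> (A *v x) = (transpose A *v v) \<bullet> x"
  by (simp add: dot_lmul_matrix)

text \<open>Isolates the dependence on \<open>G\<close> in an isotropic noise term; definiteness and
  monotonicity are both read off from this split.\<close>

lemma received_cov_quadratic_form:
  fixes C :: "real^'d^'d" and P :: "real^'s^'d"
  shows "x \<bullet> (received_cov C Ka sigma2 gamma P G *v x) =
    ((P *v x) \<bullet> (C *v (P *v x))) / real Ka + sigma2 / (real G * (real Ka)\<^sup>2 * gamma) * (x \<bullet> x)"
proof -
  have "x \<bullet> ((transpose P ** C ** P) *v x) = (P *v x) \<bullet> (C *v (P *v x))"
    using inner_matrix_vector_transpose[of x "transpose P" "C *v (P *v x)"]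
    by (simp add: matrix_vector_mul_assoc [symmetric] del: transpose_matrix_vector)
  then show ?thesis
    unfolding received_cov_def
    by (simp add: matrix_vector_mult_add_rdistrib inner_add_right
        flip: scaleR_matrix_vector_assoc)
qed

lemma received_cov_sym_pos_def:
  fixes C :: "real^'d^'d" and P :: "real^'s^'d"
  assumes C: "sym_pos_def C" and "Ka \<ge> 1" "sigma2 > 0" "gamma > 0" "G \<ge> 1"
  shows "sym_pos_def (received_cov C Ka sigma2 gamma P G)"
  unfolding sym_pos_def_def
proof (intro conjI allI impI)
  show "transpose (received_cov C Ka sigma2 gamma P G) = received_cov C Ka sigma2 gamma P G"
    using C unfolding received_cov_def sym_pos_def_def
    by (simp add: transpose_add transpose_scalar matrix_transpose_mul transpose_mat
        matrix_mul_assoc)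
next
  fix x :: "real^'s"
  assume "x \<noteq> 0"
  have "(P *v x) \<bullet> (C *v (P *v x)) \<ge> 0"
    using C unfolding sym_pos_def_def by (cases "P *v x = 0") (auto intro: less_imp_le)
  \<comment> \<open>Strict positivity comes from the noise; the signal term only has to be
    nonnegative.\<close>
  moreover have "sigma2 / (real G * (real Ka)\<^sup>2 * gamma) * (x \<bullet> x) > 0"
    using assms \<open>x \<noteq> 0\<close> by simp
  ultimately show "x \<bullet> (received_cov C Ka sigma2 gamma P G *v x) > 0"
    unfolding received_cov_quadratic_form by (simp add: add_nonneg_pos)
qed

lemma received_cov_antimono:
  fixes C :: "real^'d^'d" and P :: "real^'s^'d"
  assumes "Ka \<ge> 1" "sigma2 > 0" "gamma > 0" "1 \<le> G" "G \<le> H"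
  shows "x \<bullet> (received_cov C Ka sigma2 gamma P H *v x)
    \<le> x \<bullet> (received_cov C Ka sigma2 gamma P G *v x)"
proof -
  \<comment> \<open>The bound \<open>1 \<le> G\<close> matters: at \<open>G = 0\<close>, division by
    zero would turn the right-hand side into 0.\<close>
  have "sigma2 / (real H * (real Ka)\<^sup>2 * gamma) \<le> sigma2 / (real G * (real Ka)\<^sup>2 * gamma)"
    using assms by (intro divide_left_mono mult_right_mono mult_pos_pos) auto
  then show ?thesis
    unfolding received_cov_quadratic_form by (intro add_left_mono mult_right_mono) auto
qed

lemma receive_discriminant_gain_mono:
  fixes C :: "real^'d^'d" and P :: "real^'s^'d"
  assumes "sym_pos_def C" "Ka \<ge> 1" "sigma2 > 0" "gamma > 0" "1 \<le> G" "G \<le> H"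
  shows "receive_discriminant_gain mu p C Ka sigma2 gamma P G
    \<le> receive_discriminant_gain mu p C Ka sigma2 gamma P H"
proof -
  \<comment> \<open>Moving \<open>P\<close> across the inner product gives the shape required by
    \<open>matrix_inv_antimono\<close>, with the same vector for every \<open>G\<close>.\<close>
  have gain: "receive_discriminant_gain mu p C Ka sigma2 gamma P G =
      (transpose P *v (mu (fst p) - mu (snd p))) \<bullet>
      (matrix_inv (received_cov C Ka sigma2 gamma P G) *v
       (transpose P *v (mu (fst p) - mu (snd p))))" for G
    unfolding receive_discriminant_gain_def Let_def
    by (simp add: inner_matrix_vector_transpose matrix_vector_mul_assoc [symmetric]
        del: transpose_matrix_vector)
  show ?thesis
    unfolding gain using assms
    by (intro matrix_inv_antimono received_cov_sym_pos_def received_cov_antimono) auto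
qed

theorem lemma4:
  fixes mu :: "nat \<Rightarrow> real^'d"
    and C :: "real^'d^'d"
    and P :: "real^'s^'d"
    and L Ka l l' :: nat
    and sigma2 gamma_sen :: real
  assumes "CARD('d) \<ge> 2"
    and "L \<ge> 2"
    and "sym_pos_def C"
    and "Ka \<ge> 1"
    and "sigma2 > 0"
    and "gamma_sen > 0"
    and "CARD('s) \<in> {1..CARD('d)}"
    and "rank P = CARD('s)"
    and "closest_class_pair L mu C (l, l')"
  shows "\<forall>G \<in> {1..CARD('d) - 1}.
           receive_discriminant_gain mu (l, l') C Ka sigma2 gamma_sen P (G + 1)
           \<ge> receive_discriminant_gain mu (l, l') C Ka sigma2 gamma_sen P G"
  using assms by (auto intro!: receive_discriminant_gain_mono)

end
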